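(* For all $k\ge 1$, $$I_{213\dots k}(x)=\frac{1}{x\,U_k\left(\frac{1}{2x}\right)}\sum_{j=0}^{k-1}U_j\left(\frac{1}{2x}\right),$$ where $213\dots k$ is the permutation $(2,1,3,4,\dots,k)\in S_k$ (the pattern $21$ for $k=2$, and the pattern $1$ for $k=1$), $I_{213\dots k}(x)=\sum_{n\ge 0}I_{213\dots k}(n)x^n$, and $I_{213\dots k}(n)$ is the number of involutions in $S_n$ avoiding both $132$ and $213\dots k$.
   Context: $S_n$ is the set of permutations of $\{1,\dots,n\}$. A permutation $\alpha\in S_n$ contains a pattern $\tau\in S_k$ if there are $1\le i_1<\dots<i_k\le n$ such that $(\alpha_{i_1},\dots,\alpha_{i_k})$ is order-isomorphic to $\tau$; otherwise $\alpha$ avoids $\tau$. An involution is a permutation equal to its own inverse; the empty permutation is counted for $n=0$. $U_r$ denotes the Chebyshev polynomial of the second kind, $U_r(\cos\theta)=\sin((r+1)\theta)/\sin\theta$. The identity is one of rational functions, expanded as power series in $x$. *)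

theory Defs
  imports
    Complex_Main
    "HOL-Combinatorics.Permutations"
    "HOL-Computational_Algebra.Computational_Algebra"
begin

section \<open>Pattern containment\<close>

text \<open>
  An element of \<open>S\<^sub>n\<close> is a function \<open>p\<close> with \<open>p permutes {1..n}\<close>; its word is \<open>p 1, \<dots>, p n\<close>.
  Since such a \<open>p\<close> does not determine \<open>n\<close>, sizes are passed explicitly.
\<close>

definition contains_pattern :: "nat \<Rightarrow> (nat \<Rightarrow> nat) \<Rightarrow> nat \<Rightarrow> (nat \<Rightarrow> nat) \<Rightarrow> bool" where
  "contains_pattern n \<alpha> k \<tau> \<longleftrightarrow>
     (\<exists>i :: nat \<Rightarrow> nat. i ` {1..k} \<subseteq> {1..n} \<and> strict_mono_on {1..k} i \<and>
        (\<forall>a\<in>{1..k}. \<forall>b\<in>{1..k}. \<alpha> (i a) < \<alpha> (i b) \<longleftrightarrow> \<tau> a < \<tau> b))"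

abbreviation avoids_pattern :: "nat \<Rightarrow> (nat \<Rightarrow> nat) \<Rightarrow> nat \<Rightarrow> (nat \<Rightarrow> nat) \<Rightarrow> bool" where
  "avoids_pattern n \<alpha> k \<tau> \<equiv> \<not> contains_pattern n \<alpha> k \<tau>"

definition pattern_132 :: "nat \<Rightarrow> nat" where
  "pattern_132 = transpose 2 3"

text \<open>For \<open>k = 1\<close> the pattern is the permutation \<open>1\<close>, which has no second letter to exchange.\<close>

definition pattern_213_upto :: "nat \<Rightarrow> nat \<Rightarrow> nat" where
  "pattern_213_upto k = (if k < 2 then id else transpose 1 2)"

lemma pattern_132_word: "map pattern_132 [1, 2, 3] = [1, 3, 2]"
  by (simp add: pattern_132_def transpose_def)

lemma pattern_132_permutes: "pattern_132 permutes {1..3}"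
  unfolding pattern_132_def by (rule permutes_swap_id) auto

lemma pattern_213_upto_word:
  "map (pattern_213_upto 1) [1..<2] = [1]"
  "k \<ge> 2 \<Longrightarrow> map (pattern_213_upto k) [1..<Suc k] = 2 # 1 # [3..<Suc k]"
proof -
  show "map (pattern_213_upto 1) [1..<2] = [1]"
    by (simp add: pattern_213_upto_def upt_rec)
next
  assume k: "k \<ge> 2"
  then have "[1..<Suc k] = 1 # 2 # [3..<Suc k]"
    by (simp add: upt_rec numeral_2_eq_2 numeral_3_eq_3)
  moreover have "map (transpose 1 2) [3..<Suc k] = [3..<Suc k]"
    by (rule map_idI) (auto simp: transpose_def)
  ultimately show "map (pattern_213_upto k) [1..<Suc k] = 2 # 1 # [3..<Suc k]"
    using k by (simp add: pattern_213_upto_def del: upt_Suc)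
qed

lemma pattern_213_upto_permutes: "pattern_213_upto k permutes {1..k}"
  unfolding pattern_213_upto_def by (auto intro!: permutes_swap_id permutes_id)

definition num_involutions_avoiding :: "nat \<Rightarrow> nat \<Rightarrow> nat" where
  "num_involutions_avoiding k n =
     card {\<alpha>. \<alpha> permutes {1..n} \<and> inv \<alpha> = \<alpha> \<and>
              avoids_pattern n \<alpha> 3 pattern_132 \<and>
              avoids_pattern n \<alpha> k (pattern_213_upto k)}"

definition involutions_avoiding_gf :: "nat \<Rightarrow> real fps" where
  "involutions_avoiding_gf k = Abs_fps (\<lambda>n. of_nat (num_involutions_avoiding k n))"


section \<open>Chebyshev polynomials of the second kind\<close>

definition chebyshev_U :: "nat \<Rightarrow> real poly" where
  "chebyshev_U r =
     (THE p. \<forall>\<theta>. sin \<theta> \<noteq> 0 \<longrightarrow> poly p (cos \<theta>) = sin (real (r + 1) * \<theta>) / sin \<theta>)"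

lemma chebyshev_U_unique:
  fixes p q :: "real poly"
  assumes p: "\<And>\<theta>. sin \<theta> \<noteq> 0 \<Longrightarrow> poly p (cos \<theta>) = sin (real (r + 1) * \<theta>) / sin \<theta>"
    and q: "\<And>\<theta>. sin \<theta> \<noteq> 0 \<Longrightarrow> poly q (cos \<theta>) = sin (real (r + 1) * \<theta>) / sin \<theta>"
  shows "p = q"
proof (rule ccontr)
  assume "p \<noteq> q"
  then have "finite {t. poly (p - q) t = 0}"
    by (intro poly_roots_finite) simp
  moreover have "{-1<..<1} \<subseteq> {t. poly (p - q) t = 0}"
  proof
    fix t :: real
    assume t: "t \<in> {-1<..<1}"
    then have "sin (arccos t) \<noteq> 0"
      by (auto simp: sin_arccos_nonzero)
    then have "poly p (cos (arccos t)) = poly q (cos (arccos t))"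
      using p q by simp
    then show "t \<in> {t. poly (p - q) t = 0}"
      using t by simp
  qed
  ultimately have "finite {-1<..<1::real}"
    by (rule rev_finite_subset)
  then show False
    using infinite_Ioo[of "-1" "1::real"] by simp
qed

lemma chebyshev_U_exists:
  "\<exists>p :: real poly. \<forall>\<theta>. sin \<theta> \<noteq> 0 \<longrightarrow> poly p (cos \<theta>) = sin (real (r + 1) * \<theta>) / sin \<theta>"
proof (induction r rule: less_induct)
  case (less r)
  consider "r = 0" | "r = 1" | s where "r = s + 2"
    by (metis One_nat_def add_2_eq_Suc' not0_implies_Suc)
  then show ?case
  proof cases
    case 1
    then show ?thesis by (intro exI[of _ 1]) simp
  next
    case 2
    then show ?thesis by (intro exI[of _ "[:0, 2:]"]) (simp add: sin_double)
  next
    case (3 s)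
    obtain p where p: "\<And>\<theta>. sin \<theta> \<noteq> 0 \<Longrightarrow> poly p (cos \<theta>) = sin (real (s + 1) * \<theta>) / sin \<theta>"
      using less[of s] 3 by auto
    obtain q where q: "\<And>\<theta>. sin \<theta> \<noteq> 0 \<Longrightarrow> poly q (cos \<theta>) = sin (real (s + 2) * \<theta>) / sin \<theta>"
      using less[of "s + 1"] 3 by (auto simp: add_ac)
    have "poly ([:0, 2:] * q - p) (cos \<theta>) = sin (real (r + 1) * \<theta>) / sin \<theta>"
      if "sin \<theta> \<noteq> 0" for \<theta>
    proof -
      define \<phi> where "\<phi> = real (s + 2) * \<theta>"
      have r: "real (r + 1) * \<theta> = \<phi> + \<theta>" and s: "real (s + 1) * \<theta> = \<phi> - \<theta>"
        using 3 by (simp_all add: \<phi>_def algebra_simps)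
      have pq: "poly p (cos \<theta>) = sin (\<phi> - \<theta>) / sin \<theta>" "poly q (cos \<theta>) = sin \<phi> / sin \<theta>"
        using p[OF that] q[OF that] unfolding s \<phi>_def by simp_all
      have "poly ([:0, 2:] * q - p) (cos \<theta>) =
          2 * cos \<theta> * (sin \<phi> / sin \<theta>) - sin (\<phi> - \<theta>) / sin \<theta>"
        by (simp add: pq)
      also have "\<dots> = sin (\<phi> + \<theta>) / sin \<theta>"
        using that by (simp add: sin_add sin_diff field_simps)
      finally show ?thesis
        unfolding r .
    qed
    then show ?thesis by blast
  qed
qed

lemma chebyshev_U_trig:
  assumes "sin \<theta> \<noteq> 0"
  shows "poly (chebyshev_U r) (cos \<theta>) = sin (real (r + 1) * \<theta>) / sin \<theta>"
proof -
  have "\<exists>!p :: real poly. \<forall>\<theta>. sin \<theta> \<noteq> 0 \<longrightarrow> poly p (cos \<theta>) = sin (real (r + 1) * \<theta>) / sin \<theta>"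
    using chebyshev_U_exists[of r] chebyshev_U_unique[of _ r] by blast
  from theI'[OF this] show ?thesis
    using assms unfolding chebyshev_U_def by blast
qed

text \<open>
  Rational functions and power series in \<open>x\<close> both embed into the field of formal Laurent series,
  with \<open>x\<close> mapped to \<open>fls_X\<close>; the coefficients of the polynomial are embedded as constants.
\<close>

definition chebyshev_U_at :: "nat \<Rightarrow> real fls \<Rightarrow> real fls" where
  "chebyshev_U_at r t = poly (map_poly fls_const (chebyshev_U r)) t"

end

theory Submission
  imports Defs
begin

text \<open>
  Splitting a 132-avoiding permutation at its maximum writes it as the skew sum of
  \<open>\<beta> \<oplus> 1\<close> and \<open>\<gamma>\<close>. For \<open>k \<ge> 3\<close> the pattern \<open>213\<dots>k\<close> is skew-indecomposable, so the skew sum avoids it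
  iff \<open>\<beta>\<close> avoids \<open>213\<dots>(k-1)\<close> and \<open>\<gamma>\<close> avoids \<open>213\<dots>k\<close>; hence \<open>F\<^sub>k = 1 + x F\<^sub>k\<^sub>-\<^sub>1 F\<^sub>k\<close> for the
  generating function of all avoiders. An involution either fixes its maximum or is the skew sum
  of \<open>\<beta> \<oplus> 1\<close>, a smaller involution, and the inverse of \<open>\<beta> \<oplus> 1\<close>; hence
  \<open>I\<^sub>k = 1 + x I\<^sub>k\<^sub>-\<^sub>1 + x\<^sup>2 F\<^sub>k\<^sub>-\<^sub>1(x\<^sup>2) I\<^sub>k\<close>. Both recurrences also hold at \<open>k = 2\<close>. With
  \<open>u\<^sub>k = U\<^sub>k(1/(2x))\<close>, so that \<open>x u\<^sub>k\<^sub>+\<^sub>1 = u\<^sub>k - x u\<^sub>k\<^sub>-\<^sub>1\<close>, induction gives first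
  \<open>x u\<^sub>k F\<^sub>k(x\<^sup>2) = u\<^sub>k\<^sub>-\<^sub>1\<close> (in particular \<open>u\<^sub>k \<noteq> 0\<close>) and then \<open>x u\<^sub>k I\<^sub>k = u\<^sub>0 + \<dots> + u\<^sub>k\<^sub>-\<^sub>1\<close>.
\<close>

section \<open>Skew sums\<close>

text \<open>The word of \<open>a\<close> raised by \<open>l\<close>, followed by the word of
  \<open>b\<close>. Outside \<open>{1..m + l}\<close> the value is that of the identity, as
  \<open>permutes\<close> demands.\<close>

definition skew_sum :: "nat \<Rightarrow> (nat \<Rightarrow> nat) \<Rightarrow> nat \<Rightarrow> (nat \<Rightarrow> nat) \<Rightarrow> nat \<Rightarrow> nat" where
  "skew_sum m a l b i =
     (if 1 \<le> i \<and> i \<le> m then a i + l else if m < i \<and> i \<le> m + l then b (i - m) else i)"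

lemma skew_sum_left: "i \<in> {1..m} \<Longrightarrow> skew_sum m a l b i = a i + l"
  and skew_sum_right: "i \<in> {1..l} \<Longrightarrow> skew_sum m a l b (i + m) = b i"
  by (auto simp: skew_sum_def)

lemma permutes_interval_bounds:
  assumes "a permutes {1..m::nat}" and "i \<in> {1..m}"
  shows "1 \<le> a i" "a i \<le> m"
  using permutes_in_image[OF assms(1), of i] assms(2) by auto

text \<open>Inversion reflects the diagram of a permutation in the diagonal, so the upper left and
  lower right blocks change places and each is inverted.\<close>

lemma skew_sum_inverse:
  assumes a: "a permutes {1..m}" and b: "b permutes {1..l}"
  shows "skew_sum l (inv b) m (inv a) (skew_sum m a l b i) = i"
proof -
  consider "i \<in> {1..m}" | "m < i" "i - m \<in> {1..l}" | "i \<notin> {1..m + l}" by force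
  then show ?thesis
  proof cases
    case 1
    then show ?thesis
      using permutes_interval_bounds[OF a 1] permutes_inverses[OF a] by (auto simp: skew_sum_def)
  next
    case 2
    then show ?thesis
      using permutes_interval_bounds[OF b 2(2)] permutes_inverses[OF b] by (auto simp: skew_sum_def)
  qed (auto simp: skew_sum_def)
qed

lemma
  assumes a: "a permutes {1..m}" and b: "b permutes {1..l}"
  shows skew_sum_permutes: "skew_sum m a l b permutes {1..m + l}"
    and inv_skew_sum: "inv (skew_sum m a l b) = skew_sum l (inv b) m (inv a)"
proof -
  note ab = skew_sum_inverse[OF a b]
  have ba: "skew_sum m a l b (skew_sum l (inv b) m (inv a) i) = i" for i
    using skew_sum_inverse[OF permutes_inv[OF b] permutes_inv[OF a]]
    by (simp add: permutes_inv_inv[OF a] permutes_inv_inv[OF b])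
  show "inv (skew_sum m a l b) = skew_sum l (inv b) m (inv a)"
    by (rule inv_equality) (use ab ba in auto)
  have "bij (skew_sum m a l b)"
    by (rule bijI') (metis ab, metis ba)
  then show "skew_sum m a l b permutes {1..m + l}"
    unfolding permutes_def by (auto simp: skew_sum_def bij_iff)
qed

lemma skew_sum_assoc:
  "skew_sum m a (l + r) (skew_sum l b r c) = skew_sum (m + l) (skew_sum m a l b) r c"
  by (auto simp: skew_sum_def fun_eq_iff)

lemma skew_sum_inject:
  assumes a: "a permutes {1..m}" "a' permutes {1..m}"
    and b: "b permutes {1..l}" "b' permutes {1..l}"
    and eq: "skew_sum m a l b = skew_sum m a' l b'"
  shows "a = a'" "b = b'"
proof -
  have "a i = a' i" if "i \<in> {1..m}" for i
    using fun_cong[OF eq, of i] that by (simp add: skew_sum_def)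
  then show "a = a'"
    using permutes_not_in[OF a(1)] permutes_not_in[OF a(2)] by (metis ext)
  have "b i = b' i" if "i \<in> {1..l}" for i
    using fun_cong[OF eq, of "i + m"] that by (simp add: skew_sum_def)
  then show "b = b'"
    using permutes_not_in[OF b(1)] permutes_not_in[OF b(2)] by (metis ext)
qed

text \<open>By \<open>desc\<close> the last \<open>l\<close> positions carry a downward closed set
  of values; having \<open>l\<close> elements, it is \<open>{1..l}\<close>. The first
  \<open>m\<close> positions take the remaining values, and lowering these by \<open>l\<close> gives
  \<open>a\<close>.\<close>

lemma skew_sum_exists:
  assumes perm: "\<alpha> permutes {1..m + l}"
    and desc: "\<And>p q. p \<in> {1..m} \<Longrightarrow> q \<in> {m<..m + l} \<Longrightarrow> \<alpha> q < \<alpha> p"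
  obtains a b where "a permutes {1..m}" "b permutes {1..l}" "\<alpha> = skew_sum m a l b"
proof -
  define V where "V = \<alpha> ` {m<..m + l}"
  have inj: "inj \<alpha>" using perm by (rule permutes_inj)
  have cardV: "card V = l"
    unfolding V_def using inj by (simp add: card_image inj_on_subset)
  have down: "u \<in> V" if "v \<in> V" "1 \<le> u" "u \<le> v" for u v
  proof -
    obtain q where q: "q \<in> {m<..m + l}" "v = \<alpha> q" using \<open>v \<in> V\<close> V_def by auto
    have "v \<le> m + l" using q permutes_interval_bounds[OF perm, of q] by auto
    then have "u \<in> \<alpha> ` {1..m + l}"
      using that permutes_image[OF perm] by auto
    then obtain p where p: "p \<in> {1..m + l}" "u = \<alpha> p" by auto
    have "p \<notin> {1..m}"
      using desc[of p q] p q that by auto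
    with p show ?thesis unfolding V_def by auto
  qed
  have Vpos: "v \<ge> 1" if "v \<in> V" for v
    using that permutes_interval_bounds[OF perm] unfolding V_def by force
  have finV: "finite V" by (simp add: V_def)
  have V: "V = {1..l}"
  proof (cases "V = {}")
    case True
    then show ?thesis using cardV by auto
  next
    case False
    have "V = {1..Max V}"
    proof (rule set_eqI)
      show "u \<in> V \<longleftrightarrow> u \<in> {1..Max V}" for u
        using down[OF Max_in[OF finV False], of u] Vpos[of u] Max_ge[OF finV, of u]
        unfolding atLeastAtMost_iff by blast
    qed
    moreover from this have "l = Max V" using cardV by (metis card_atLeastAtMost diff_Suc_1)
    ultimately show ?thesis by simp
  qed
  have img: "\<alpha> ` {1..m} = {l<..m + l}"
  proof -
    have "\<alpha> ` {1..m} = \<alpha> ` ({1..m + l} - {m<..m + l})"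
      by (rule arg_cong[of _ _ "(`) \<alpha>"]) auto
    also have "\<dots> = {1..m + l} - V"
      unfolding V_def by (simp only: image_set_diff[OF inj] permutes_image[OF perm])
    finally show ?thesis unfolding V by auto
  qed
  define a where "a i = (if i \<in> {1..m} then \<alpha> i - l else i)" for i
  define b where "b i = (if i \<in> {1..l} then \<alpha> (i + m) else i)" for i
  have gt: "\<alpha> i > l" "\<alpha> i \<le> m + l" if "i \<in> {1..m}" for i
    using img that by auto
  have "bij_betw a {1..m} {1..m}"
  proof (rule bij_betw_imageI)
    show "inj_on a {1..m}"
    proof (rule inj_onI)
      fix x y assume *: "x \<in> {1..m}" "y \<in> {1..m}" "a x = a y"
      then have "\<alpha> x = \<alpha> y" using gt[of x] gt[of y] by (auto simp: a_def)
      then show "x = y" using inj by (auto dest: injD)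
    qed
    have "a ` {1..m} = (\<lambda>v. v - l) ` \<alpha> ` {1..m}"
      unfolding image_image by (rule image_cong) (auto simp: a_def)
    also have "\<dots> = {1..m}"
      unfolding img by (auto simp: image_iff intro!: bexI[of _ "_ + l"])
    finally show "a ` {1..m} = {1..m}" .
  qed
  then have a: "a permutes {1..m}"
    by (rule bij_imp_permutes) (auto simp: a_def)
  have "bij_betw b {1..l} {1..l}"
  proof (rule bij_betw_imageI)
    show "inj_on b {1..l}"
      by (rule inj_onI) (auto simp: b_def dest: injD[OF inj])
    have "b ` {1..l} = \<alpha> ` (\<lambda>i. i + m) ` {1..l}"
      unfolding image_image by (rule image_cong) (auto simp: b_def)
    also have "(\<lambda>i. i + m) ` {1..l} = {m<..m + l}"
      by (auto simp: image_iff intro!: bexI[of _ "_ - m"])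
    finally show "b ` {1..l} = {1..l}" using V V_def by simp
  qed
  then have b: "b permutes {1..l}"
    by (rule bij_imp_permutes) (auto simp: b_def)
  have "\<alpha> i = skew_sum m a l b i" for i
    using gt[of i] permutes_not_in[OF perm, of i]
    by (auto simp: skew_sum_def a_def b_def)
  then show ?thesis using that a b by blast
qed

section \<open>Pattern containment\<close>

text \<open>
  The hypothesis \<open>\<tau> 1 < \<tau> k\<close> forces skew-indecomposability: an occurrence meeting both blocks
  would place its first letter above its last.
\<close>

lemma contains_pattern_skew_sum:
  assumes a: "a permutes {1..m}" and b: "b permutes {1..l}"
    and k: "1 \<le> k" and indecomposable: "\<tau> 1 < \<tau> k"
  shows "contains_pattern (m + l) (skew_sum m a l b) k \<tau> \<longleftrightarrow>
         contains_pattern m a k \<tau> \<or> contains_pattern l b k \<tau>"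
proof
  assume "contains_pattern (m + l) (skew_sum m a l b) k \<tau>"
  then obtain i where i: "i ` {1..k} \<subseteq> {1..m + l}" "strict_mono_on {1..k} i"
    and occ: "\<And>p q. p \<in> {1..k} \<Longrightarrow> q \<in> {1..k} \<Longrightarrow>
      skew_sum m a l b (i p) < skew_sum m a l b (i q) \<longleftrightarrow> \<tau> p < \<tau> q"
    unfolding contains_pattern_def by blast
  have mono: "i p \<le> i q" if "p \<in> {1..k}" "q \<in> {1..k}" "p \<le> q" for p q
    using strict_mono_on_imp_mono_on[OF i(2)] that by (auto simp: mono_on_def)
  \<comment> \<open>Positions increase along an occurrence, so its first and last positions decide
    whether it lies in one block or meets both.\<close>
  consider "i k \<le> m" | "i 1 > m" | "i 1 \<le> m" "i k > m" by linarith
  then show "contains_pattern m a k \<tau> \<or> contains_pattern l b k \<tau>"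
  proof cases
    case 1
    then have le: "i p \<in> {1..m}" if "p \<in> {1..k}" for p
      using mono[of p k] that i(1) k by fastforce
    have "contains_pattern m a k \<tau>"
      unfolding contains_pattern_def
    proof (intro exI[of _ i] conjI ballI)
      fix p q assume pq: "p \<in> {1..k}" "q \<in> {1..k}"
      show "a (i p) < a (i q) \<longleftrightarrow> \<tau> p < \<tau> q"
        using occ[OF pq] le[OF pq(1)] le[OF pq(2)] by (simp add: skew_sum_def)
    qed (use le i in auto)
    then show ?thesis ..
  next
    case 2
    have gt: "i p \<in> {m<..m + l}" if "p \<in> {1..k}" for p
      using mono[of 1 p] that i(1) k 2 by fastforce
    have "contains_pattern l b k \<tau>"
      unfolding contains_pattern_def
    proof (intro exI[of _ "\<lambda>p. i p - m"] conjI ballI)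
      fix p q assume pq: "p \<in> {1..k}" "q \<in> {1..k}"
      show "b (i p - m) < b (i q - m) \<longleftrightarrow> \<tau> p < \<tau> q"
        using occ[OF pq] gt[OF pq(1)] gt[OF pq(2)] by (simp add: skew_sum_def)
    next
      show "(\<lambda>p. i p - m) ` {1..k} \<subseteq> {1..l}" using gt by fastforce
      show "strict_mono_on {1..k} (\<lambda>p. i p - m)"
        using i(2) gt by (fastforce simp: strict_mono_on_def intro!: diff_less_mono)
    qed
    then show ?thesis ..
  next
    case 3
    have "i 1 \<in> {1..m}" "i k \<in> {m<..m + l}" using i(1) 3 k by force+
    then have "skew_sum m a l b (i 1) > skew_sum m a l b (i k)"
      using permutes_interval_bounds[OF a, of "i 1"] permutes_interval_bounds[OF b, of "i k - m"]
      by (force simp: skew_sum_def)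
    moreover have "skew_sum m a l b (i 1) < skew_sum m a l b (i k)"
      using occ[of 1 k] indecomposable k by auto
    ultimately show ?thesis by simp
  qed
next
  assume "contains_pattern m a k \<tau> \<or> contains_pattern l b k \<tau>"
  then show "contains_pattern (m + l) (skew_sum m a l b) k \<tau>"
  proof
    assume "contains_pattern m a k \<tau>"
    then obtain i where i: "i ` {1..k} \<subseteq> {1..m}" "strict_mono_on {1..k} i"
      "\<forall>p\<in>{1..k}. \<forall>q\<in>{1..k}. a (i p) < a (i q) \<longleftrightarrow> \<tau> p < \<tau> q"
      unfolding contains_pattern_def by blast
    have range: "i p \<in> {1..m}" if "p \<in> {1..k}" for p using i(1) that by blast
    show ?thesis
      unfolding contains_pattern_def
    proof (intro exI[of _ i] conjI ballI)
      fix p q assume pq: "p \<in> {1..k}" "q \<in> {1..k}"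
      show "skew_sum m a l b (i p) < skew_sum m a l b (i q) \<longleftrightarrow> \<tau> p < \<tau> q"
        using i(3) pq by (simp only: skew_sum_left range) simp
    next
      show "i ` {1..k} \<subseteq> {1..m + l}" using range by force
    qed (rule i(2))
  next
    assume "contains_pattern l b k \<tau>"
    then obtain i where i: "i ` {1..k} \<subseteq> {1..l}" "strict_mono_on {1..k} i"
      "\<forall>p\<in>{1..k}. \<forall>q\<in>{1..k}. b (i p) < b (i q) \<longleftrightarrow> \<tau> p < \<tau> q"
      unfolding contains_pattern_def by blast
    have range: "i p \<in> {1..l}" if "p \<in> {1..k}" for p using i(1) that by blast
    show ?thesis
      unfolding contains_pattern_def
    proof (intro exI[of _ "\<lambda>p. i p + m"] conjI ballI)
      fix p q assume pq: "p \<in> {1..k}" "q \<in> {1..k}"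
      show "skew_sum m a l b (i p + m) < skew_sum m a l b (i q + m) \<longleftrightarrow> \<tau> p < \<tau> q"
        using i(3) pq by (simp only: skew_sum_right range)
    next
      show "(\<lambda>p. i p + m) ` {1..k} \<subseteq> {1..m + l}" using range by force
      show "strict_mono_on {1..k} (\<lambda>p. i p + m)" using i(2) by (simp add: strict_mono_on_def)
    qed
  qed
qed

text \<open>
  As functions, \<open>\<alpha>\<close> and \<open>\<alpha> \<oplus> 1\<close> coincide, since a permutation of \<open>{1..n}\<close> fixes \<open>n + 1\<close>; only the
  size changes. The same applies to \<open>\<tau>\<close>.
\<close>

lemma contains_pattern_append_max:
  assumes \<alpha>: "\<alpha> permutes {1..n}" and \<tau>: "\<tau> permutes {1..k}"
  shows "contains_pattern (Suc n) \<alpha> (Suc k) \<tau> \<longleftrightarrow> contains_pattern n \<alpha> k \<tau>"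
proof
  assume "contains_pattern (Suc n) \<alpha> (Suc k) \<tau>"
  then obtain i where i: "i ` {1..Suc k} \<subseteq> {1..Suc n}" "strict_mono_on {1..Suc k} i"
    "\<forall>p\<in>{1..Suc k}. \<forall>q\<in>{1..Suc k}. \<alpha> (i p) < \<alpha> (i q) \<longleftrightarrow> \<tau> p < \<tau> q"
    unfolding contains_pattern_def by blast
  \<comment> \<open>Dropping the last letter of any occurrence leaves only positions below
    \<open>Suc n\<close>.\<close>
  have "i p \<in> {1..n}" if "p \<in> {1..k}" for p
  proof -
    have "i p < i (Suc k)" using i(2) that by (auto simp: strict_mono_on_def)
    moreover have "i (Suc k) \<le> Suc n" "i p \<ge> 1" using i(1) that by fastforce+
    ultimately show ?thesis by auto
  qed
  with i show "contains_pattern n \<alpha> k \<tau>"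
    unfolding contains_pattern_def
    by (intro exI[of _ i]) (auto simp: strict_mono_on_def)
next
  assume "contains_pattern n \<alpha> k \<tau>"
  then obtain i where i: "i ` {1..k} \<subseteq> {1..n}" "strict_mono_on {1..k} i"
    and occ: "\<And>p q. p \<in> {1..k} \<Longrightarrow> q \<in> {1..k} \<Longrightarrow> \<alpha> (i p) < \<alpha> (i q) \<longleftrightarrow> \<tau> p < \<tau> q"
    unfolding contains_pattern_def by blast
  \<comment> \<open>The letter at \<open>Suc n\<close> is last and largest in the word, as is the
    letter at \<open>Suc k\<close> in the pattern, so the one can represent the other.\<close>
  define j where "j = i(Suc k := Suc n)"
  have range: "i p \<in> {1..n}" if "p \<in> {1..k}" for p using i(1) that by blast
  have \<alpha>le: "\<alpha> (i p) \<le> n" if "p \<in> {1..k}" for p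
    using permutes_interval_bounds[OF \<alpha> range[OF that]] by simp
  have \<tau>le: "\<tau> p \<le> k" if "p \<in> {1..k}" for p
    using permutes_interval_bounds[OF \<tau> that] by simp
  have fix1: "\<alpha> (Suc n) = Suc n" "\<tau> (Suc k) = Suc k"
    using permutes_not_in[OF \<alpha>] permutes_not_in[OF \<tau>] by auto
  have "\<alpha> (j p) < \<alpha> (j q) \<longleftrightarrow> \<tau> p < \<tau> q" if pq: "p \<in> {1..Suc k}" "q \<in> {1..Suc k}" for p q
  proof -
    consider "p \<in> {1..k}" "q \<in> {1..k}" | "p \<in> {1..k}" "q = Suc k" | "p = Suc k" "q \<in> {1..k}"
      | "p = Suc k" "q = Suc k" using pq by force
    then show ?thesis
    proof cases
      case 1
      then show ?thesis using occ[OF 1] by (auto simp: j_def)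
    next
      case 2
      then show ?thesis using \<alpha>le[of p] \<tau>le[of p] fix1 by (auto simp: j_def)
    next
      case 3
      then show ?thesis using \<alpha>le[of q] \<tau>le[of q] fix1 by (auto simp: j_def)
    qed simp
  qed
  moreover have "j ` {1..Suc k} \<subseteq> {1..Suc n}"
  proof
    fix y assume "y \<in> j ` {1..Suc k}"
    then obtain p where "p \<in> {1..Suc k}" "y = j p" by auto
    then show "y \<in> {1..Suc n}" using range[of p] by (cases "p = Suc k") (auto simp: j_def)
  qed
  moreover have "strict_mono_on {1..Suc k} j"
  proof (rule strict_mono_onI)
    fix p q assume pq: "p \<in> {1..Suc k}" "q \<in> {1..Suc k}" "p < q"
    then have p: "p \<in> {1..k}" by auto
    show "j p < j q"
    proof (cases "q = Suc k")
      case True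
      then show ?thesis using range[OF p] p by (auto simp: j_def)
    next
      case False
      then show ?thesis using i(2) pq p by (auto simp: j_def strict_mono_on_def)
    qed
  qed
  ultimately show "contains_pattern (Suc n) \<alpha> (Suc k) \<tau>"
    unfolding contains_pattern_def by blast
qed

text \<open>Inversion exchanges positions and values: the values of an occurrence in
  \<open>\<alpha>\<close> become the positions of an occurrence in
  \<open>inv \<alpha>\<close>.\<close>

lemma contains_pattern_inv:
  assumes \<alpha>: "\<alpha> permutes {1..n}" and \<tau>: "\<tau> permutes {1..k}"
    and "contains_pattern n \<alpha> k \<tau>"
  shows "contains_pattern n (inv \<alpha>) k (inv \<tau>)"
proof -
  obtain i where i: "i ` {1..k} \<subseteq> {1..n}" "strict_mono_on {1..k} i"
    and occ: "\<And>p q. p \<in> {1..k} \<Longrightarrow> q \<in> {1..k} \<Longrightarrow> \<alpha> (i p) < \<alpha> (i q) \<longleftrightarrow> \<tau> p < \<tau> q"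
    using assms(3) unfolding contains_pattern_def by blast
  have \<tau>': "inv \<tau> p \<in> {1..k}" if "p \<in> {1..k}" for p
    using permutes_in_image[OF permutes_inv[OF \<tau>]] that by blast
  have less: "i p < i q \<longleftrightarrow> p < q" if "p \<in> {1..k}" "q \<in> {1..k}" for p q
    using i(2) that by (simp add: strict_mono_on_less)
  show ?thesis
    unfolding contains_pattern_def
  \<comment> \<open>The letter \<open>a\<close> of the occurrence has rank \<open>\<tau> a\<close>
    among its values, so the value of rank \<open>p\<close> belongs to the letter
    \<open>inv \<tau> p\<close>.\<close>
  proof (intro exI[of _ "\<lambda>p. \<alpha> (i (inv \<tau> p))"] conjI ballI)
    show "(\<lambda>p. \<alpha> (i (inv \<tau> p))) ` {1..k} \<subseteq> {1..n}"
      using \<tau>' i(1) permutes_in_image[OF \<alpha>] by blast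
    show "strict_mono_on {1..k} (\<lambda>p. \<alpha> (i (inv \<tau> p)))"
      by (rule strict_mono_onI) (simp only: occ \<tau>' permutes_inverses[OF \<tau>])
    fix p q assume pq: "p \<in> {1..k}" "q \<in> {1..k}"
    show "inv \<alpha> (\<alpha> (i (inv \<tau> p))) < inv \<alpha> (\<alpha> (i (inv \<tau> q))) \<longleftrightarrow> inv \<tau> p < inv \<tau> q"
      using less[OF \<tau>'[OF pq(1)] \<tau>'[OF pq(2)]] by (simp add: permutes_inverses[OF \<alpha>])
  qed
qed


section \<open>Occurrences of 132 and 21 as inequalities\<close>

lemma contains_132_iff:
  "contains_pattern n \<alpha> 3 pattern_132 \<longleftrightarrow>
     (\<exists>p q r. 1 \<le> p \<and> p < q \<and> q < r \<and> r \<le> n \<and> \<alpha> p < \<alpha> r \<and> \<alpha> r < \<alpha> q)"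
proof
  have three: "{1..3} = {1, 2, 3::nat}" by auto
  assume "contains_pattern n \<alpha> 3 pattern_132"
  then obtain i where i: "i ` {1..3} \<subseteq> {1..n}" "strict_mono_on {1..3} i"
    and occ: "\<forall>a\<in>{1..3}. \<forall>b\<in>{1..3}. \<alpha> (i a) < \<alpha> (i b) \<longleftrightarrow> pattern_132 a < pattern_132 b"
    unfolding contains_pattern_def by blast
  have "i 1 < i 2" "i 2 < i 3" using i(2) by (auto simp: strict_mono_on_def)
  moreover have "1 \<le> i 1" "i 3 \<le> n" using i(1) unfolding three by auto
  moreover have "\<alpha> (i 1) < \<alpha> (i 3)" "\<alpha> (i 3) < \<alpha> (i 2)"
    using occ by (auto simp: pattern_132_def transpose_def)
  ultimately show "\<exists>p q r. 1 \<le> p \<and> p < q \<and> q < r \<and> r \<le> n \<and> \<alpha> p < \<alpha> r \<and> \<alpha> r < \<alpha> q"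
    by blast
next
  have three: "{1..3} = {1, 2, 3::nat}" by auto
  assume "\<exists>p q r. 1 \<le> p \<and> p < q \<and> q < r \<and> r \<le> n \<and> \<alpha> p < \<alpha> r \<and> \<alpha> r < \<alpha> q"
  then obtain p q r where "1 \<le> p" "p < q" "q < r" "r \<le> n" "\<alpha> p < \<alpha> r" "\<alpha> r < \<alpha> q" by blast
  then show "contains_pattern n \<alpha> 3 pattern_132"
    unfolding contains_pattern_def three
    by (intro exI[of _ "\<lambda>x. if x = 1 then p else if x = 2 then q else r"])
      (auto simp: strict_mono_on_def pattern_132_def transpose_def)
qed

lemma contains_21_iff:
  "contains_pattern n \<alpha> 2 (pattern_213_upto 2) \<longleftrightarrow> (\<exists>p q. 1 \<le> p \<and> p < q \<and> q \<le> n \<and> \<alpha> q < \<alpha> p)"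
proof
  have two: "{1..2} = {1, 2::nat}" by auto
  assume "contains_pattern n \<alpha> 2 (pattern_213_upto 2)"
  then obtain i where i: "i ` {1..2} \<subseteq> {1..n}" "strict_mono_on {1..2} i"
    and occ: "\<forall>a\<in>{1..2}. \<forall>b\<in>{1..2}. \<alpha> (i a) < \<alpha> (i b) \<longleftrightarrow> pattern_213_upto 2 a < pattern_213_upto 2 b"
    unfolding contains_pattern_def by blast
  have "i 1 < i 2" using i(2) by (auto simp: strict_mono_on_def)
  moreover have "1 \<le> i 1" "i 2 \<le> n" using i(1) unfolding two by auto
  moreover have "\<alpha> (i 2) < \<alpha> (i 1)"
    using occ by (auto simp: pattern_213_upto_def transpose_def)
  ultimately show "\<exists>p q. 1 \<le> p \<and> p < q \<and> q \<le> n \<and> \<alpha> q < \<alpha> p"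
    by blast
next
  have two: "{1..2} = {1, 2::nat}" by auto
  assume "\<exists>p q. 1 \<le> p \<and> p < q \<and> q \<le> n \<and> \<alpha> q < \<alpha> p"
  then obtain p q where "1 \<le> p" "p < q" "q \<le> n" "\<alpha> q < \<alpha> p" by blast
  then show "contains_pattern n \<alpha> 2 (pattern_213_upto 2)"
    unfolding contains_pattern_def two
    by (intro exI[of _ "\<lambda>x. if x = 1 then p else q"])
      (auto simp: strict_mono_on_def pattern_213_upto_def transpose_def)
qed

section \<open>Decomposition at the maximum\<close>

definition avoiders :: "nat \<Rightarrow> nat \<Rightarrow> (nat \<Rightarrow> nat) set" where
  "avoiders k n = {\<alpha>. \<alpha> permutes {1..n} \<and> avoids_pattern n \<alpha> 3 pattern_132 \<and>
                      avoids_pattern n \<alpha> k (pattern_213_upto k)}"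

definition involution_avoiders :: "nat \<Rightarrow> nat \<Rightarrow> (nat \<Rightarrow> nat) set" where
  "involution_avoiders k n = {\<alpha> \<in> avoiders k n. inv \<alpha> = \<alpha>}"

lemma num_involutions_avoiding_eq:
  "num_involutions_avoiding k n = card (involution_avoiders k n)"
  unfolding num_involutions_avoiding_def involution_avoiders_def avoiders_def
  by (rule arg_cong[of _ _ card]) auto

lemma avoiders_permutes: "\<alpha> \<in> avoiders k n \<Longrightarrow> \<alpha> permutes {1..n}"
  by (simp add: avoiders_def)

lemma finite_avoiders: "finite (avoiders k n)"
  by (rule finite_subset[OF _ finite_permutations[of "{1..n}"]]) (auto simp: avoiders_def)

lemma finite_involution_avoiders: "finite (involution_avoiders k n)"
  unfolding involution_avoiders_def using finite_avoiders by simp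

text \<open>For \<open>k \<ge> 2\<close> the longer pattern is the shorter one with a new maximum at
  its end; from \<open>k = 1\<close> that extension would give 12 instead of 21. A final maximum
  takes no part in an occurrence of 132, whose last letter is not its largest.\<close>

lemma avoiders_append_max:
  assumes k: "2 \<le> k" and \<alpha>: "\<alpha> permutes {1..n}"
  shows "\<alpha> \<in> avoiders (Suc k) (Suc n) \<longleftrightarrow> \<alpha> \<in> avoiders k n"
proof -
  have "contains_pattern (Suc n) \<alpha> (Suc k) (pattern_213_upto (Suc k)) \<longleftrightarrow>
      contains_pattern n \<alpha> k (pattern_213_upto k)"
    using contains_pattern_append_max[OF \<alpha> pattern_213_upto_permutes, of k] k
    by (simp add: pattern_213_upto_def)
  moreover have "contains_pattern (Suc n) \<alpha> 3 pattern_132 \<longleftrightarrow> contains_pattern n \<alpha> 3 pattern_132"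
  proof -
    have "r \<le> n" if "1 \<le> p" "p < q" "q < r" "r \<le> Suc n" "\<alpha> r < \<alpha> q" for p q r
    proof (rule ccontr)
      assume "\<not> r \<le> n"
      then have "r = Suc n" "\<alpha> r = Suc n"
        using that(4) permutes_not_in[OF \<alpha>, of r] by auto
      then show False
        using permutes_interval_bounds[OF \<alpha>, of q] that by simp
    qed
    then show ?thesis
      unfolding contains_132_iff using le_SucI by blast
  qed
  moreover have "\<alpha> permutes {1..Suc n}" by (rule permutes_subset[OF \<alpha>]) auto
  ultimately show ?thesis using \<alpha> by (simp add: avoiders_def)
qed

text \<open>Both patterns begin below their last letter and are therefore skew-indecomposable. For
  the second this takes \<open>3 \<le> k\<close>: the pattern 21 is itself a skew sum.\<close>

lemma skew_sum_avoiders: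
  assumes "3 \<le> k" "a permutes {1..m}" "b permutes {1..l}"
  shows "skew_sum m a l b \<in> avoiders k (m + l) \<longleftrightarrow> a \<in> avoiders k m \<and> b \<in> avoiders k l"
proof -
  have "pattern_132 1 < pattern_132 3" "pattern_213_upto k 1 < pattern_213_upto k k"
    using assms(1) by (auto simp: pattern_132_def pattern_213_upto_def transpose_def)
  then show ?thesis
    using assms skew_sum_permutes[OF assms(2,3)]
    by (auto simp: avoiders_def contains_pattern_skew_sum)
qed

text \<open>Both patterns are involutions, so inverting an occurrence yields an occurrence of the
  same pattern.\<close>

lemma inv_avoiders:
  assumes "\<alpha> \<in> avoiders k n"
  shows "inv \<alpha> \<in> avoiders k n"
proof -
  have \<alpha>: "\<alpha> permutes {1..n}" using assms by (rule avoiders_permutes)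
  have *: "contains_pattern n \<alpha> r \<tau>"
    if "contains_pattern n (inv \<alpha>) r \<tau>" "\<tau> permutes {1..r}" "inv \<tau> = \<tau>" for r \<tau>
    using contains_pattern_inv[OF permutes_inv[OF \<alpha>] that(2,1)] that(3)
    by (simp add: permutes_inv_inv[OF \<alpha>])
  have "inv (pattern_213_upto k) = pattern_213_upto k" "inv pattern_132 = pattern_132"
    by (auto simp: pattern_213_upto_def pattern_132_def)
  then show ?thesis
    using assms permutes_inv[OF \<alpha>] *[OF _ pattern_213_upto_permutes] *[OF _ pattern_132_permutes]
    unfolding avoiders_def by blast
qed

text \<open>A letter before the maximum that was smaller than a letter after it would form 132
  together with the maximum. Hence the word is a skew sum cut just after the maximum, which stands
  at position \<open>Suc j\<close>.\<close>

lemma avoiders_decompose: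
  assumes k: "2 \<le> k" and \<alpha>: "\<alpha> \<in> avoiders (Suc k) (Suc n)"
  obtains j \<beta> \<gamma> where "j \<le> n" "\<beta> \<in> avoiders k j" "\<gamma> \<in> avoiders (Suc k) (n - j)"
    "\<alpha> = skew_sum (Suc j) \<beta> (n - j) \<gamma>"
proof -
  have perm: "\<alpha> permutes {1..Suc n}" using \<alpha> by (rule avoiders_permutes)
  then have "Suc n \<in> \<alpha> ` {1..Suc n}" using permutes_image[OF perm] by simp
  then obtain m where m: "1 \<le> m" "m \<le> Suc n" "\<alpha> m = Suc n" by auto
  define j where "j = m - 1"
  have j: "m = Suc j" "j \<le> n" "Suc j + (n - j) = Suc n" using m by (auto simp: j_def)
  have desc: "\<alpha> q < \<alpha> p" if "p \<in> {1..Suc j}" "q \<in> {Suc j<..Suc j + (n - j)}" for p q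
  proof -
    have neq: "\<alpha> p \<noteq> \<alpha> q" "\<alpha> q \<noteq> \<alpha> m"
      using that j by (auto simp: inj_eq[OF permutes_inj[OF perm]])
    have q: "\<alpha> q < \<alpha> m"
      using permutes_interval_bounds[OF perm, of q] neq(2) that j m by auto
    show ?thesis
    proof (cases "p = m")
      case False
      then have "\<not> \<alpha> p < \<alpha> q"
        using \<alpha> q that j unfolding avoiders_def contains_132_iff by force
      then show ?thesis using neq by simp
    qed (use q in simp)
  qed
  obtain \<beta> \<gamma> where \<beta>: "\<beta> permutes {1..Suc j}" and \<gamma>: "\<gamma> permutes {1..n - j}"
    and eq: "\<alpha> = skew_sum (Suc j) \<beta> (n - j) \<gamma>"
    using skew_sum_exists[of \<alpha> "Suc j" "n - j"] perm desc j(3) by metis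
  \<comment> \<open>The maximum ends the left block, so this block has the form
    \<open>\<beta> \<oplus> 1\<close> and the same function already permutes
    \<open>{1..j}\<close>.\<close>
  have "\<beta> (Suc j) = Suc j"
    using m(3) j by (simp add: eq skew_sum_def)
  then have \<beta>': "\<beta> permutes {1..j}"
    by (intro permutes_superset[OF \<beta>]) (auto simp: le_Suc_eq)
  have "\<beta> \<in> avoiders (Suc k) (Suc j)" "\<gamma> \<in> avoiders (Suc k) (n - j)"
    using skew_sum_avoiders[OF _ \<beta> \<gamma>, of "Suc k"] \<alpha> k j(3) by (simp_all add: eq)
  then show ?thesis
    using that[OF j(2) _ _ eq] avoiders_append_max[OF k \<beta>'] by blast
qed

lemma skew_sum_max_position:
  assumes \<beta>: "\<beta> permutes {1..j}" and \<gamma>: "\<gamma> permutes {1..n - j}" and "j \<le> n"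
  shows "inv (skew_sum (Suc j) \<beta> (n - j) \<gamma>) (Suc n) = Suc j"
proof -
  have \<beta>': "\<beta> permutes {1..Suc j}" by (rule permutes_subset[OF \<beta>]) auto
  have "\<beta> (Suc j) = Suc j" by (rule permutes_not_in[OF \<beta>]) simp
  then show ?thesis
    using \<open>j \<le> n\<close> by (simp add: permutes_inv_eq[OF skew_sum_permutes[OF \<beta>' \<gamma>]] skew_sum_def)
qed

text \<open>The position of the maximum recovers the cut, and blocks of known sizes are determined
  by their skew sum.\<close>

lemma skew_sum_max_inject:
  assumes "\<beta> permutes {1..j}" "\<gamma> permutes {1..n - j}" "j \<le> n"
    and "\<beta>' permutes {1..j'}" "\<gamma>' permutes {1..n - j'}" "j' \<le> n"
    and eq: "skew_sum (Suc j) \<beta> (n - j) \<gamma> = skew_sum (Suc j') \<beta>' (n - j') \<gamma>'"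
  shows "j = j' \<and> \<beta> = \<beta>' \<and> \<gamma> = \<gamma>'"
proof -
  have "Suc j = Suc j'"
    using skew_sum_max_position[OF assms(1-3)] skew_sum_max_position[OF assms(4-6)] eq by simp
  then have "j' = j" by simp
  have "\<beta> permutes {1..Suc j}" "\<beta>' permutes {1..Suc j}"
    using assms(1,4) \<open>j' = j\<close> by (auto intro: permutes_subset)
  then show ?thesis
    using skew_sum_inject assms \<open>j' = j\<close> by metis
qed

lemma skew_sum_max_avoiders:
  assumes "2 \<le> k" "j \<le> n" "\<beta> \<in> avoiders k j" "\<gamma> \<in> avoiders (Suc k) (n - j)"
  shows "skew_sum (Suc j) \<beta> (n - j) \<gamma> \<in> avoiders (Suc k) (Suc n)"
proof -
  have "\<beta> \<in> avoiders (Suc k) (Suc j)"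
    using avoiders_append_max[OF assms(1) avoiders_permutes[OF assms(3)]] assms(3) by simp
  then show ?thesis
    using skew_sum_avoiders[of "Suc k" \<beta> "Suc j" \<gamma> "n - j"] assms avoiders_permutes by simp
qed

text \<open>The coefficient form of the recurrence for all avoiders: \<open>j\<close> letters
  precede the maximum and \<open>n - j\<close> follow it.\<close>

lemma card_avoiders_Suc:
  assumes k: "2 \<le> k"
  shows "card (avoiders (Suc k) (Suc n)) =
         (\<Sum>j = 0..n. card (avoiders k j) * card (avoiders (Suc k) (n - j)))"
proof -
  let ?D = "SIGMA j : {0..n}. avoiders k j \<times> avoiders (Suc k) (n - j)"
  let ?f = "\<lambda>(j, \<beta>, \<gamma>). skew_sum (Suc j) \<beta> (n - j) \<gamma>"
  have "bij_betw ?f ?D (avoiders (Suc k) (Suc n))"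
  proof (rule bij_betw_imageI)
    show "inj_on ?f ?D"
      by (rule inj_onI) (auto dest!: skew_sum_max_inject[rotated -1] dest: avoiders_permutes)
    show "?f ` ?D = avoiders (Suc k) (Suc n)"
    proof
      show "?f ` ?D \<subseteq> avoiders (Suc k) (Suc n)"
        using skew_sum_max_avoiders[OF k] by auto
      show "avoiders (Suc k) (Suc n) \<subseteq> ?f ` ?D"
      proof
        fix \<alpha> assume "\<alpha> \<in> avoiders (Suc k) (Suc n)"
        then obtain j \<beta> \<gamma> where "j \<le> n" "\<beta> \<in> avoiders k j" "\<gamma> \<in> avoiders (Suc k) (n - j)"
          "\<alpha> = skew_sum (Suc j) \<beta> (n - j) \<gamma>"
          by (rule avoiders_decompose[OF k])
        then show "\<alpha> \<in> ?f ` ?D" by (intro image_eqI[of _ _ "(j, \<beta>, \<gamma>)"]) auto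
      qed
    qed
  qed
  then have "card (avoiders (Suc k) (Suc n)) = card ?D"
    by (simp add: bij_betw_same_card)
  also have "\<dots> = (\<Sum>j = 0..n. card (avoiders k j) * card (avoiders (Suc k) (n - j)))"
    by (simp add: card_SigmaI finite_avoiders card_cartesian_product)
  finally show ?thesis .
qed

section \<open>Involutions\<close>

text \<open>Inversion reverses the order of the three blocks \<open>a\<close>, \<open>c\<close>,
  \<open>inv a\<close> and inverts each, which restores the same sequence.\<close>

lemma inv_symmetric_skew_sum:
  assumes a: "a permutes {1..m}" and c: "c permutes {1..r}" "inv c = c"
  defines "\<alpha> \<equiv> skew_sum m a (r + m) (skew_sum r c m (inv a))"
  shows "inv \<alpha> = \<alpha>"
proof -
  note a' = permutes_inv[OF a]
  have "inv \<alpha> = skew_sum (r + m) (skew_sum m a r c) m (inv a)"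
    unfolding \<alpha>_def inv_skew_sum[OF a skew_sum_permutes[OF c(1) a']] inv_skew_sum[OF c(1) a']
    by (simp add: permutes_inv_inv[OF a] c(2))
  then show ?thesis
    unfolding \<alpha>_def skew_sum_assoc by (simp add: add.commute)
qed

text \<open>The inverse is cut at \<open>r + m\<close> instead of \<open>m\<close>. Reading the
  involution at both cuts yields three blocks of sizes \<open>m\<close>, \<open>r\<close>,
  \<open>m\<close>; uniqueness of the blocks then makes the third the inverse of the first and the
  middle one an involution.\<close>

lemma involution_skew_sum:
  assumes a: "a permutes {1..m}" and b: "b permutes {1..r + m}"
    and invol: "inv (skew_sum m a (r + m) b) = skew_sum m a (r + m) b"
  obtains c where "c permutes {1..r}" "inv c = c" "b = skew_sum r c m (inv a)"
proof -
  note a' = permutes_inv[OF a] and b' = permutes_inv[OF b]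
  have eq: "skew_sum m a (r + m) b = skew_sum (r + m) (inv b) m (inv a)"
    using inv_skew_sum[OF a b] invol by simp
  have "b q < b p" if "p \<in> {1..r}" "q \<in> {r<..r + m}" for p q
  proof -
    \<comment> \<open>In \<open>eq\<close> the position \<open>p + m\<close> lies in the second
      block on the left-hand side but, as \<open>p \<le> r\<close>, in the first block on the
      right-hand side, where values exceed \<open>m\<close>.\<close>
    have "b p = inv b (p + m) + m"
      using fun_cong[OF eq, of "p + m"] that by (simp add: skew_sum_def)
    moreover have "b q = inv a (q - r)"
      using fun_cong[OF eq, of "q + m"] that by (simp add: skew_sum_def)
    moreover have "1 \<le> inv b (p + m)"
      using permutes_interval_bounds[OF b', of "p + m"] that by (simp add: Suc_le_eq)
    moreover have "inv a (q - r) \<le> m"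
      using permutes_interval_bounds[OF a', of "q - r"] that by (auto simp: Suc_le_eq)
    ultimately show ?thesis by simp
  qed
  then obtain c d where c: "c permutes {1..r}" and d: "d permutes {1..m}"
    and beq: "b = skew_sum r c m d"
    using skew_sum_exists[OF b] by metis
  \<comment> \<open>Rebracketing moves the cut of the left-hand side to \<open>r + m\<close>, where
    the right-hand side is cut too, so that blocks can be compared.\<close>
  have "skew_sum (r + m) (skew_sum m a r c) m d = skew_sum (r + m) (inv b) m (inv a)"
    using eq skew_sum_assoc[where a = a and b = c and c = d and m = m and l = r and r = m]
    by (simp add: beq add.commute)
  moreover have "skew_sum m a r c permutes {1..r + m}"
    using skew_sum_permutes[OF a c] by (simp add: add.commute)
  ultimately have d_eq: "d = inv a" and "inv b = skew_sum m a r c"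
    using skew_sum_inject[OF _ b' d a'] by metis+
  then have "b = skew_sum r (inv c) m (inv a)"
    using inv_skew_sum[OF a c] by (metis permutes_inv_inv[OF b])
  then have "inv c = c"
    using skew_sum_inject[OF permutes_inv[OF c] c a' d] beq by metis
  then show ?thesis using that c beq d_eq by blast
qed

text \<open>The first summand counts the involutions that fix their maximum. The others have blocks
  \<open>\<beta> \<oplus> 1\<close>, a smaller involution, and the inverse of the first block, of
  sizes \<open>j + 1\<close>, \<open>n - (2 * j + 1)\<close>, \<open>j + 1\<close>. Here
  \<open>\<beta>\<close> need not be an involution.\<close>

lemma card_involution_avoiders_Suc:
  assumes k: "2 \<le> k"
  shows "card (involution_avoiders (Suc k) (Suc n)) =
         card (involution_avoiders k n) +
         (\<Sum>j | 2 * j + 1 \<le> n. card (avoiders k j) * card (involution_avoiders (Suc k) (n - (2 * j + 1))))"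
proof -
  let ?J = "{j. 2 * j + 1 \<le> n}"
  let ?D = "SIGMA j : ?J. avoiders k j \<times> involution_avoiders (Suc k) (n - (2 * j + 1))"
  \<comment> \<open>The part after the maximum; the inverse of \<open>\<beta> \<oplus> 1\<close> is
    \<open>inv \<beta>\<close> as a function, taken with size \<open>Suc j\<close>.\<close>
  let ?g = "\<lambda>j \<beta> \<gamma>. skew_sum (n - (2 * j + 1)) \<gamma> (Suc j) (inv \<beta>)"
  let ?f = "\<lambda>(j, \<beta>, \<gamma>). skew_sum (Suc j) \<beta> (n - j) (?g j \<beta> \<gamma>)"
  have finJ: "finite ?J" by (rule finite_subset[of _ "{..n}"]) auto
  have finD: "finite ?D" using finJ finite_avoiders finite_involution_avoiders by blast
  have size: "n - (2 * j + 1) + Suc j = n - j" if "2 * j + 1 \<le> n" for j using that by simp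
  have perm_Suc: "\<beta> permutes {1..Suc j}" if "\<beta> permutes {1..j}" for \<beta> j
    by (rule permutes_subset[OF that]) auto
  have g: "?g j \<beta> \<gamma> \<in> avoiders (Suc k) (n - j)"
    if "2 * j + 1 \<le> n" "\<beta> \<in> avoiders k j" "\<gamma> \<in> avoiders (Suc k) (n - (2 * j + 1))" for j \<beta> \<gamma>
  proof -
    have "\<beta> \<in> avoiders (Suc k) (Suc j)"
      using avoiders_append_max[OF k] that avoiders_permutes by blast
    then have "inv \<beta> \<in> avoiders (Suc k) (Suc j)" by (rule inv_avoiders)
    then have "?g j \<beta> \<gamma> \<in> avoiders (Suc k) (n - (2 * j + 1) + Suc j)"
      using k that(3) by (simp only: skew_sum_avoiders avoiders_permutes Suc_le_mono numeral_3_eq_3 numeral_2_eq_2)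
    then show ?thesis unfolding size[OF that(1)] .
  qed
  have inj: "inj_on ?f ?D"
  proof (rule inj_onI)
    fix x y assume xy: "x \<in> ?D" "y \<in> ?D" and eq: "?f x = ?f y"
    obtain j \<beta> \<gamma> j' \<beta>' \<gamma>' where split: "x = (j, \<beta>, \<gamma>)" "y = (j', \<beta>', \<gamma>')"
      by (cases x, cases y) auto
    have *: "2 * j + 1 \<le> n" "\<beta> \<in> avoiders k j" "\<gamma> \<in> avoiders (Suc k) (n - (2 * j + 1))"
      and **: "2 * j' + 1 \<le> n" "\<beta>' \<in> avoiders k j'" "\<gamma>' \<in> avoiders (Suc k) (n - (2 * j' + 1))"
      using xy split by (auto simp: involution_avoiders_def)
    have "j = j' \<and> \<beta> = \<beta>' \<and> ?g j \<beta> \<gamma> = ?g j' \<beta>' \<gamma>'"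
      by (rule skew_sum_max_inject[where n = n, OF avoiders_permutes[OF *(2)] avoiders_permutes[OF g[OF *]] _
            avoiders_permutes[OF **(2)] avoiders_permutes[OF g[OF **]]])
        (use *(1) **(1) eq split in auto)
    then have j': "j' = j" "\<beta>' = \<beta>" and geq: "?g j \<beta> \<gamma> = ?g j \<beta> \<gamma>'" by auto
    have "inv \<beta> permutes {1..Suc j}"
      by (intro permutes_inv perm_Suc avoiders_permutes[OF *(2)])
    then have "\<gamma> = \<gamma>'"
      using skew_sum_inject(1) avoiders_permutes[OF *(3)] avoiders_permutes[OF **(3)] geq
      unfolding j' by metis
    then show "x = y" using split j' by simp
  qed
  \<comment> \<open>The last letter lies after the maximum and is at most \<open>n - j\<close>,
    which separates these involutions from those that fix their maximum.\<close>
  have not_fixed: "\<alpha> (Suc n) \<noteq> Suc n" if "\<alpha> \<in> ?f ` ?D" for \<alpha>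
  proof -
    obtain j \<beta> \<gamma> where *: "2 * j + 1 \<le> n" "\<beta> \<in> avoiders k j"
      "\<gamma> \<in> involution_avoiders (Suc k) (n - (2 * j + 1))" "\<alpha> = ?f (j, \<beta>, \<gamma>)"
      using \<open>\<alpha> \<in> ?f ` ?D\<close> by auto
    then have "?g j \<beta> \<gamma> permutes {1..n - j}"
      by (intro avoiders_permutes[OF g]) (auto simp: involution_avoiders_def)
    moreover have "n - j \<in> {1..n - j}" using *(1) by simp
    ultimately have "?g j \<beta> \<gamma> (n - j) \<le> n - j" by (rule permutes_interval_bounds)
    moreover have "\<alpha> (Suc n) = ?g j \<beta> \<gamma> (n - j)" using * by (simp add: skew_sum_def)
    ultimately show ?thesis by simp
  qed
  have "involution_avoiders (Suc k) (Suc n) = involution_avoiders k n \<union> ?f ` ?D"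
  proof
    show "involution_avoiders (Suc k) (Suc n) \<subseteq> involution_avoiders k n \<union> ?f ` ?D"
    proof
      fix \<alpha> assume "\<alpha> \<in> involution_avoiders (Suc k) (Suc n)"
      then have \<alpha>: "\<alpha> \<in> avoiders (Suc k) (Suc n)" "inv \<alpha> = \<alpha>"
        by (auto simp: involution_avoiders_def)
      obtain j \<beta> b where j: "j \<le> n" and \<beta>: "\<beta> \<in> avoiders k j"
        and b: "b \<in> avoiders (Suc k) (n - j)" and eq: "\<alpha> = skew_sum (Suc j) \<beta> (n - j) b"
        using avoiders_decompose[OF k \<alpha>(1)] .
      have \<beta>p: "\<beta> permutes {1..Suc j}" using perm_Suc avoiders_permutes \<beta> by blast
      have bp: "b permutes {1..n - j}" using avoiders_permutes b by blast
      have "inv \<alpha> (Suc n) = Suc j"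
        unfolding eq by (rule skew_sum_max_position[OF avoiders_permutes[OF \<beta>] bp j])
      then have at_max: "\<alpha> (Suc n) = Suc j" by (simp only: \<alpha>(2))
      show "\<alpha> \<in> involution_avoiders k n \<union> ?f ` ?D"
      proof (cases "j = n")
        case True
        then have "\<alpha> permutes {1..n}"
          using at_max
          by (intro permutes_superset[OF avoiders_permutes[OF \<alpha>(1)]]) (auto simp: le_Suc_eq)
        then show ?thesis
          using avoiders_append_max[OF k] \<alpha> by (auto simp: involution_avoiders_def)
      next
        case False
        then have "\<alpha> (Suc n) = b (n - j)" using j by (simp add: eq skew_sum_def)
        \<comment> \<open>The maximum stands at \<open>Suc j\<close>, so in an involution the last
          letter is \<open>Suc j\<close>. It belongs to \<open>b\<close>, whose values are at most
          \<open>n - j\<close>; hence a second block of size \<open>Suc j\<close> fits.\<close>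
        then have "Suc j \<le> n - j"
          using permutes_interval_bounds[OF bp, of "n - j"] at_max False j by simp
        then have J: "2 * j + 1 \<le> n" by simp
        obtain c where c: "c permutes {1..n - (2 * j + 1)}" "inv c = c"
          "b = skew_sum (n - (2 * j + 1)) c (Suc j) (inv \<beta>)"
          using involution_skew_sum[OF \<beta>p, of b "n - (2 * j + 1)"] bp \<alpha>(2) size[OF J] eq by metis
        have "c \<in> avoiders (Suc k) (n - (2 * j + 1))"
          using skew_sum_avoiders[OF _ c(1) permutes_inv[OF \<beta>p], of "Suc k"] k b c(3)
          unfolding size[OF J] by simp
        then have "(j, \<beta>, c) \<in> ?D" using J \<beta> c by (simp add: involution_avoiders_def)
        moreover have "\<alpha> = ?f (j, \<beta>, c)" using eq c(3) by simp
        ultimately show ?thesis by blast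
      qed
    qed
    have "?f (j, \<beta>, \<gamma>) \<in> involution_avoiders (Suc k) (Suc n)"
      if J: "2 * j + 1 \<le> n" and \<beta>: "\<beta> \<in> avoiders k j"
        and \<gamma>: "\<gamma> \<in> involution_avoiders (Suc k) (n - (2 * j + 1))" for j \<beta> \<gamma>
    proof -
      have \<gamma>': "\<gamma> \<in> avoiders (Suc k) (n - (2 * j + 1))" "inv \<gamma> = \<gamma>"
        using \<gamma> by (auto simp: involution_avoiders_def)
      have "?f (j, \<beta>, \<gamma>) \<in> avoiders (Suc k) (Suc n)"
        using skew_sum_max_avoiders[OF k _ \<beta> g[OF J \<beta> \<gamma>'(1)]] J by simp
      moreover have "inv (?f (j, \<beta>, \<gamma>)) = ?f (j, \<beta>, \<gamma>)"
        using inv_symmetric_skew_sum[OF perm_Suc[OF avoiders_permutes[OF \<beta>]]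
            avoiders_permutes[OF \<gamma>'(1)] \<gamma>'(2)] unfolding size[OF J] by simp
      ultimately show ?thesis by (simp add: involution_avoiders_def)
    qed
    moreover have "involution_avoiders k n \<subseteq> involution_avoiders (Suc k) (Suc n)"
      using avoiders_append_max[OF k] avoiders_permutes by (auto simp: involution_avoiders_def)
    ultimately show "involution_avoiders k n \<union> ?f ` ?D \<subseteq> involution_avoiders (Suc k) (Suc n)"
      by auto
  qed
  moreover have "involution_avoiders k n \<inter> ?f ` ?D = {}"
  proof -
    have "\<alpha> (Suc n) = Suc n" if "\<alpha> \<in> involution_avoiders k n" for \<alpha>
      using that permutes_not_in[of \<alpha> "{1..n}" "Suc n"]
      by (auto simp: involution_avoiders_def avoiders_def)
    then show ?thesis using not_fixed by blast
  qed
  ultimately have "card (involution_avoiders (Suc k) (Suc n)) =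
      card (involution_avoiders k n) + card (?f ` ?D)"
    using finD by (simp add: card_Un_disjoint finite_involution_avoiders)
  also have "card (?f ` ?D) = card ?D" by (rule card_image[OF inj])
  also have "\<dots> =
      (\<Sum>j | 2 * j + 1 \<le> n. card (avoiders k j) * card (involution_avoiders (Suc k) (n - (2 * j + 1))))"
    using finJ
    by (simp add: card_SigmaI finite_avoiders finite_involution_avoiders card_cartesian_product)
  finally show ?thesis .
qed


section \<open>Generating functions\<close>

lemma avoiders_0: "1 \<le> k \<Longrightarrow> avoiders k 0 = {id}"
  by (auto simp: avoiders_def contains_pattern_def)

lemma avoiders_1_Suc: "avoiders 1 (Suc n) = {}"
proof -
  have "contains_pattern (Suc n) \<alpha> 1 (pattern_213_upto 1)" for \<alpha>
    unfolding contains_pattern_def by (intro exI[of _ id]) (auto simp: strict_mono_on_def)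
  then show ?thesis by (simp add: avoiders_def)
qed

text \<open>Without inversions the maximum must stand last, hence is fixed, and can be removed by
  induction.\<close>

lemma permutes_increasing_id:
  assumes "\<alpha> permutes {1..n::nat}" "\<And>p q. 1 \<le> p \<Longrightarrow> p < q \<Longrightarrow> q \<le> n \<Longrightarrow> \<not> \<alpha> q < \<alpha> p"
  shows "\<alpha> = id"
  using assms
proof (induction n)
  case (Suc n)
  have "Suc n \<in> \<alpha> ` {1..Suc n}" using permutes_image[OF Suc.prems(1)] by simp
  then obtain m where m: "m \<in> {1..Suc n}" "\<alpha> m = Suc n" by auto
  have "\<alpha> (Suc n) = Suc n"
  proof (rule ccontr)
    assume neq: "\<alpha> (Suc n) \<noteq> Suc n"
    then have "\<alpha> (Suc n) < \<alpha> m"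
      using permutes_interval_bounds[OF Suc.prems(1), of "Suc n"] m(2) by simp
    moreover have "m < Suc n" using m neq by (cases "m = Suc n") auto
    ultimately show False using Suc.prems(2)[of m "Suc n"] m(1) by simp
  qed
  then have "\<alpha> permutes {1..n}"
    by (intro permutes_superset[OF Suc.prems(1)]) (auto simp: le_Suc_eq)
  then show ?case using Suc.IH Suc.prems(2) by simp
qed auto

lemma avoiders_2: "avoiders 2 n = {id}"
proof
  show "avoiders 2 n \<subseteq> {id}"
    using permutes_increasing_id by (auto simp: avoiders_def contains_21_iff)
  show "{id} \<subseteq> avoiders 2 n"
    by (auto simp: avoiders_def contains_21_iff contains_132_iff permutes_id)
qed

definition avoiders_gf :: "nat \<Rightarrow> real fps" where
  "avoiders_gf k = Abs_fps (\<lambda>n. of_nat (card (avoiders k n)))"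

lemma involutions_avoiding_gf_eq:
  "involutions_avoiding_gf k = Abs_fps (\<lambda>n. of_nat (card (involution_avoiders k n)))"
  by (simp add: involutions_avoiding_gf_def num_involutions_avoiding_eq)

lemma avoiders_gf_1: "avoiders_gf 1 = 1"
  and involutions_avoiding_gf_1: "involutions_avoiding_gf 1 = 1"
proof -
  have "card (avoiders 1 n) = (if n = 0 then 1 else 0)"
    "card (involution_avoiders 1 n) = (if n = 0 then 1 else 0)" for n
    using avoiders_0[of 1] avoiders_1_Suc
    by (cases n; simp add: involution_avoiders_def Collect_conv_if conj_commute)+
  then show "avoiders_gf 1 = 1" "involutions_avoiding_gf 1 = 1"
    by (simp_all add: avoiders_gf_def involutions_avoiding_gf_eq fps_eq_iff)
qed

text \<open>Only the identity avoids 21, so both series are \<open>1 / (1 - x)\<close>.\<close>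

lemma avoiders_gf_2: "avoiders_gf 2 = Abs_fps (\<lambda>_. 1)"
  and involutions_avoiding_gf_2: "involutions_avoiding_gf 2 = Abs_fps (\<lambda>_. 1)"
proof -
  have "involution_avoiders 2 n = {id}" for n
    by (auto simp: involution_avoiders_def avoiders_2)
  then show "avoiders_gf 2 = Abs_fps (\<lambda>_. 1)" "involutions_avoiding_gf 2 = Abs_fps (\<lambda>_. 1)"
    by (simp_all add: avoiders_gf_def involutions_avoiding_gf_eq avoiders_2)
qed

text \<open>For \<open>k \<ge> 2\<close> this sums the counting recurrence. For
  \<open>k = 1\<close>, where the pattern 21 is skew-decomposable, it is the geometric series
  identity \<open>1 / (1 - x) = 1 + x / (1 - x)\<close>.\<close>

lemma avoiders_gf_Suc:
  assumes "1 \<le> k"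
  shows "avoiders_gf (Suc k) = 1 + fps_X * (avoiders_gf k * avoiders_gf (Suc k))"
proof (cases "k = 1")
  case True
  then have "Suc k = 2" by simp
  then show ?thesis
    unfolding True by (simp only: avoiders_gf_1 avoiders_gf_2) (simp add: fps_eq_iff)
next
  case False
  then have k: "2 \<le> k" using assms by simp
  show ?thesis
  proof (rule fps_ext)
    fix n
    show "avoiders_gf (Suc k) $ n = (1 + fps_X * (avoiders_gf k * avoiders_gf (Suc k))) $ n"
    proof (cases n)
      case 0
      then show ?thesis by (simp add: avoiders_gf_def avoiders_0)
    next
      case (Suc n')
      then show ?thesis
        by (simp add: avoiders_gf_def card_avoiders_Suc[OF k] fps_mult_nth[of "Abs_fps _" "Abs_fps _"])
    qed
  qed
qed

text \<open>The letters of \<open>\<beta>\<close> are counted twice, once in its inverse, hence the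
  substitution of \<open>fps_X ^ 2\<close>; the factor \<open>fps_X ^ 2\<close> stands for the
  maximum and the last letter, which the involution exchanges. For \<open>k = 1\<close> the claim
  reads \<open>1 / (1 - x) = 1 + x + x^2 / (1 - x)\<close>.\<close>

lemma involutions_avoiding_gf_Suc:
  assumes "1 \<le> k"
  shows "involutions_avoiding_gf (Suc k) = 1 + fps_X * involutions_avoiding_gf k +
    fps_X ^ 2 * ((avoiders_gf k oo fps_X ^ 2) * involutions_avoiding_gf (Suc k))"
proof (cases "k = 1")
  case True
  then have "Suc k = 2" by simp
  then show ?thesis
    unfolding True
    by (simp only: avoiders_gf_1 involutions_avoiding_gf_1 involutions_avoiding_gf_2)
      (auto simp: fps_eq_iff fps_X_power_mult_nth)
next
  case False
  then have k: "2 \<le> k" using assms by simp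
  let ?G = "avoiders_gf k oo fps_X ^ 2" and ?I = "involutions_avoiding_gf (Suc k)"
  \<comment> \<open>Only even coefficients of \<open>?G\<close> survive, so the convolution runs
    over the indices \<open>2 * j\<close>.\<close>
  have conv: "(?G * ?I) $ n = (\<Sum>j | 2 * j \<le> n. real (card (avoiders k j)) * ?I $ (n - 2 * j))" for n
  proof -
    have "(?G * ?I) $ n = (\<Sum>i = 0..n. ?G $ i * ?I $ (n - i))"
      by (rule fps_mult_nth)
    also have "\<dots> = (\<Sum>i \<in> (\<lambda>j. 2 * j) ` {j. 2 * j \<le> n}. ?G $ i * ?I $ (n - i))"
      by (rule sum.mono_neutral_right) (auto simp: fps_nth_compose_X_power elim!: dvdE)
    also have "\<dots> = (\<Sum>j | 2 * j \<le> n. ?G $ (2 * j) * ?I $ (n - 2 * j))"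
      by (subst sum.reindex) (auto simp: inj_on_def)
    finally show ?thesis by (simp add: fps_nth_compose_X_power avoiders_gf_def)
  qed
  show ?thesis
  proof (rule fps_ext)
    fix n
    consider "n = 0" | "n = 1" | n' where "n = Suc (Suc n')"
      by (metis One_nat_def not0_implies_Suc)
    then show "?I $ n = (1 + fps_X * involutions_avoiding_gf k + fps_X ^ 2 * (?G * ?I)) $ n"
    proof cases
      case 1
      then show ?thesis
        by (simp add: involutions_avoiding_gf_eq involution_avoiders_def avoiders_0 Collect_conv_if conj_commute)
    next
      case 2
      then show ?thesis
        using card_involution_avoiders_Suc[OF k, of 0]
        by (simp add: involutions_avoiding_gf_eq fps_X_power_mult_nth)
    next
      case (3 n')
      \<comment> \<open>In the counting recurrence at \<open>Suc n'\<close> the condition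
        \<open>2 * j + 1 \<le> Suc n'\<close> becomes \<open>2 * j \<le> n'\<close>, the range of
        the convolution at \<open>n'\<close>.\<close>
      have "?I $ n = involutions_avoiding_gf k $ Suc n' + (?G * ?I) $ n'"
        unfolding conv using card_involution_avoiders_Suc[OF k, of "Suc n'"] 3
        by (simp add: involutions_avoiding_gf_eq)
      then show ?thesis using 3 by (simp add: fps_X_power_mult_nth)
    qed
  qed
qed

section \<open>Chebyshev recurrences\<close>

lemma chebyshev_U_0: "chebyshev_U 0 = 1"
  by (rule chebyshev_U_unique[of _ 0]) (simp_all add: chebyshev_U_trig)

lemma chebyshev_U_1: "chebyshev_U (Suc 0) = [:0, 2:]"
  by (rule chebyshev_U_unique[of _ "Suc 0"]) (simp_all add: chebyshev_U_trig sin_double)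

text \<open>The sum formula \<open>sin (\<phi> + \<theta>) + sin (\<phi> - \<theta>) = 2 * cos
  \<theta> * sin \<phi>\<close>, transferred to polynomials by uniqueness.\<close>

lemma chebyshev_U_Suc_Suc:
  "chebyshev_U (Suc (Suc r)) = [:0, 2:] * chebyshev_U (Suc r) - chebyshev_U r"
proof (rule chebyshev_U_unique[of _ "Suc (Suc r)"])
  fix \<theta> :: real
  assume \<theta>: "sin \<theta> \<noteq> 0"
  define \<phi> where "\<phi> = real (Suc r + 1) * \<theta>"
  have "real (Suc (Suc r) + 1) * \<theta> = \<phi> + \<theta>" "real (r + 1) * \<theta> = \<phi> - \<theta>"
    by (simp_all add: \<phi>_def algebra_simps)
  moreover have "2 * cos \<theta> * (sin \<phi> / sin \<theta>) - sin (\<phi> - \<theta>) / sin \<theta> = sin (\<phi> + \<theta>) / sin \<theta>"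
    using \<theta> by (simp add: sin_add sin_diff field_simps)
  moreover have "poly [:0, 2:] (cos \<theta>) = 2 * cos \<theta>" by simp
  ultimately show "poly ([:0, 2:] * chebyshev_U (Suc r) - chebyshev_U r) (cos \<theta>) =
      sin (real (Suc (Suc r) + 1) * \<theta>) / sin \<theta>"
    by (simp only: poly_diff poly_mult chebyshev_U_trig[OF \<theta>] flip: \<phi>_def)
qed (rule chebyshev_U_trig)

lemma chebyshev_U_at_0: "chebyshev_U_at 0 t = 1"
  by (simp add: chebyshev_U_at_def chebyshev_U_0)

lemma chebyshev_U_at_1: "chebyshev_U_at (Suc 0) t = 2 * t"
  by (simp add: chebyshev_U_at_def chebyshev_U_1 map_poly_pCons)

lemma chebyshev_U_at_Suc_Suc:
  "chebyshev_U_at (Suc (Suc r)) t = 2 * t * chebyshev_U_at (Suc r) t - chebyshev_U_at r t"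
proof -
  have diff: "map_poly fls_const (p - q) = map_poly fls_const p - map_poly fls_const q"
    for p q :: "real poly"
    by (rule poly_eqI) (simp add: coeff_map_poly fls_minus_const)
  have "[:0, 2:] * chebyshev_U (Suc r) = pCons 0 (smult 2 (chebyshev_U (Suc r)))"
    by simp
  then show ?thesis
    by (simp add: chebyshev_U_at_def chebyshev_U_Suc_Suc diff map_poly_pCons map_poly_smult)
qed

section \<open>Chebyshev polynomials at 1/(2x) and the generating functions\<close>

abbreviation chebyshev_U_inv_2X :: "nat \<Rightarrow> real fls" where
  "chebyshev_U_inv_2X r \<equiv> chebyshev_U_at r (1 / (2 * fls_X))"

lemma X_chebyshev_U_inv_2X_1: "fls_X * chebyshev_U_inv_2X (Suc 0) = 1"
proof -
  have "2 * (1 / (2 * fls_X)) = 1 / (fls_X :: real fls)" by simp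
  moreover have "(fls_X :: real fls) \<noteq> 0" by simp
  ultimately show ?thesis
    unfolding chebyshev_U_at_1 by (metis nonzero_divide_eq_eq mult.commute)
qed

text \<open>The coefficient \<open>2 * t\<close> of the recurrence is the value of
  \<open>U_1\<close>, and \<open>x * U_1(1/(2x)) = 1\<close>; multiplying by \<open>x\<close>
  therefore removes it.\<close>

lemma X_chebyshev_U_inv_2X_Suc_Suc:
  "fls_X * chebyshev_U_inv_2X (Suc (Suc r)) =
   chebyshev_U_inv_2X (Suc r) - fls_X * chebyshev_U_inv_2X r"
proof -
  have "fls_X * chebyshev_U_inv_2X (Suc (Suc r)) =
      fls_X * chebyshev_U_inv_2X (Suc 0) * chebyshev_U_inv_2X (Suc r) - fls_X * chebyshev_U_inv_2X r"
    by (simp only: chebyshev_U_at_Suc_Suc[of r] chebyshev_U_at_1 right_diff_distrib mult.assoc)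
  then show ?thesis by (simp only: X_chebyshev_U_inv_2X_1 mult_1_left)
qed

text \<open>Nonvanishing is carried along because each new value is a factor of a product equal to
  the preceding, nonzero value; the final division relies on it.\<close>

lemma chebyshev_U_avoiders_gf:
  "chebyshev_U_inv_2X k \<noteq> 0 \<and> chebyshev_U_inv_2X (Suc k) \<noteq> 0 \<and>
   fls_X * chebyshev_U_inv_2X (Suc k) * fps_to_fls (avoiders_gf (Suc k) oo fps_X ^ 2) =
     chebyshev_U_inv_2X k"
proof (induction k)
  case 0
  have "avoiders_gf (Suc 0) = 1" using avoiders_gf_1 by simp
  moreover have "chebyshev_U_inv_2X (Suc 0) \<noteq> 0" using X_chebyshev_U_inv_2X_1 by auto
  ultimately show ?case by (simp only: chebyshev_U_at_0 X_chebyshev_U_inv_2X_1) simp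
next
  case (Suc k)
  let ?u = "\<lambda>r. chebyshev_U_inv_2X r" and ?G = "\<lambda>r. fps_to_fls (avoiders_gf r oo fps_X ^ 2)"
  define X where "X = (fls_X :: real fls)"
  have "avoiders_gf (Suc (Suc k)) oo fps_X ^ 2 =
      1 + fps_X ^ 2 * ((avoiders_gf (Suc k) oo fps_X ^ 2) * (avoiders_gf (Suc (Suc k)) oo fps_X ^ 2))"
    by (subst avoiders_gf_Suc) (simp_all add: fps_compose_add_distrib fps_compose_mult_distrib)
  then have "?G (Suc (Suc k)) = 1 + X ^ 2 * (?G (Suc k) * ?G (Suc (Suc k)))"
    unfolding X_def
    by (metis fls_times_fps_to_fls fps_X_to_fls fps_one_to_fls fps_to_fls_plus fps_to_fls_power)
  then have G: "?G (Suc (Suc k)) * (1 - X ^ 2 * ?G (Suc k)) = 1"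
    by (simp add: algebra_simps)
  have IH: "?u (Suc k) \<noteq> 0" "X * ?u (Suc k) * ?G (Suc k) = ?u k"
    using Suc by (auto simp: X_def)
  have "X * ?u (Suc (Suc k)) = ?u (Suc k) - X * ?u k"
    unfolding X_def by (rule X_chebyshev_U_inv_2X_Suc_Suc)
  \<comment> \<open>The induction hypothesis turns \<open>?u k\<close> into a multiple of
    \<open>?u (Suc k)\<close>; the remaining factor is the reciprocal of
    \<open>?G (Suc (Suc k))\<close> by \<open>G\<close>.\<close>
  also have "\<dots> = ?u (Suc k) * (1 - X ^ 2 * ?G (Suc k))"
    unfolding IH(2)[symmetric] by (simp add: algebra_simps power2_eq_square)
  finally have "X * ?u (Suc (Suc k)) * ?G (Suc (Suc k)) =
      ?u (Suc k) * (?G (Suc (Suc k)) * (1 - X ^ 2 * ?G (Suc k)))"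
    by simp
  then have eq: "X * ?u (Suc (Suc k)) * ?G (Suc (Suc k)) = ?u (Suc k)"
    by (simp only: G mult_1_right)
  then have "?u (Suc (Suc k)) \<noteq> 0" using IH(1) by auto
  then show ?case using IH(1) eq by (simp add: X_def)
qed

text \<open>The factor \<open>1 - X ^ 2 * ?G (Suc k)\<close> also appears when the recurrence for
  involutions is solved for the new series. What remains is
  \<open>?u (Suc k) * (1 + X * ?I (Suc k))\<close>: the new summand plus the previous sum.\<close>

lemma chebyshev_U_involutions_gf:
  "fls_X * chebyshev_U_inv_2X (Suc k) * fps_to_fls (involutions_avoiding_gf (Suc k)) =
     (\<Sum>j = 0..k. chebyshev_U_inv_2X j)"
proof (induction k)
  case 0
  have "involutions_avoiding_gf (Suc 0) = 1" using involutions_avoiding_gf_1 by simp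
  then show ?case by (simp only: X_chebyshev_U_inv_2X_1) (simp add: chebyshev_U_at_0)
next
  case (Suc k)
  let ?u = "\<lambda>r. chebyshev_U_inv_2X r" and ?G = "\<lambda>r. fps_to_fls (avoiders_gf r oo fps_X ^ 2)"
    and ?I = "\<lambda>r. fps_to_fls (involutions_avoiding_gf r)"
  define X where "X = (fls_X :: real fls)"
  have "involutions_avoiding_gf (Suc (Suc k)) = 1 + fps_X * involutions_avoiding_gf (Suc k) +
      fps_X ^ 2 * ((avoiders_gf (Suc k) oo fps_X ^ 2) * involutions_avoiding_gf (Suc (Suc k)))"
    by (rule involutions_avoiding_gf_Suc) simp
  then have "?I (Suc (Suc k)) = 1 + X * ?I (Suc k) + X ^ 2 * (?G (Suc k) * ?I (Suc (Suc k)))"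
    unfolding X_def
    by (metis fls_times_fps_to_fls fps_X_to_fls fps_one_to_fls fps_to_fls_plus fps_to_fls_power)
  then have I: "?I (Suc (Suc k)) * (1 - X ^ 2 * ?G (Suc k)) = 1 + X * ?I (Suc k)"
    by (simp add: algebra_simps)
  have G: "X * ?u (Suc k) * ?G (Suc k) = ?u k"
    using chebyshev_U_avoiders_gf[of k] by (simp add: X_def)
  have "X * ?u (Suc (Suc k)) = ?u (Suc k) - X * ?u k"
    unfolding X_def by (rule X_chebyshev_U_inv_2X_Suc_Suc)
  also have "\<dots> = ?u (Suc k) * (1 - X ^ 2 * ?G (Suc k))"
    unfolding G[symmetric] by (simp add: algebra_simps power2_eq_square)
  finally have "X * ?u (Suc (Suc k)) * ?I (Suc (Suc k)) =
      ?u (Suc k) * (?I (Suc (Suc k)) * (1 - X ^ 2 * ?G (Suc k)))"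
    by simp
  also have "\<dots> = ?u (Suc k) + X * ?u (Suc k) * ?I (Suc k)"
    unfolding I by (simp add: algebra_simps)
  finally show ?case using Suc by (simp add: X_def)
qed

theorem theorem2p9:
  fixes k :: nat
  assumes "k \<ge> 1"
  shows "fps_to_fls (involutions_avoiding_gf k) =
           1 / (fls_X * chebyshev_U_at k (1 / (2 * fls_X))) *
           (\<Sum>j = 0..k - 1. chebyshev_U_at j (1 / (2 * fls_X)))"
proof -
  obtain r where k: "k = Suc r" using assms by (cases k) auto
  \<comment> \<open>Division by zero would give 0 in the field of Laurent series, so the denominator
    must be shown nonzero.\<close>
  have "fls_X * chebyshev_U_inv_2X k \<noteq> 0"
    using chebyshev_U_avoiders_gf[of r] by (simp add: k)
  then show ?thesis
    using chebyshev_U_involutions_gf[of r] by (simp add: k field_simps)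
qed

end
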